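(* Let $q=q(n)$ be any sequence of integers with $2\leq q(n)\leq n$ for all $n\ge 2$. Then there is a sequence $\varepsilon_n\to 0$ such that, asymptotically almost surely as $n\to\infty$ (i.e. with probability tending to $1$), the uniformly random $n\times n$ jigsaw puzzle with $q=q(n)$ colors (with rotation of pieces allowed) has more than $$\left(\min\left(q^2,\frac{n^2}{q^2}\right)\right)^{(1-\varepsilon_n)n^2}$$ distinguishable solutions.
   Context: Random puzzle: the $n\times n$ board is cut into $n^2$ unit square cells. The resulting grid has $2n(n+1)$ unit edges (including those on the boundary of the board), and each of them is colored independently and uniformly at random with one of $q$ colors. The cell at each position, together with the colors of its four sides, is a jigsaw piece; thus two pieces that share a side have the same color on that side. Assemblies: the $n^2$ pieces are put unordered in a box, and their orientations are forgotten. Pieces may be rotated by multiples of $90^\circ$ but not flipped. A solution (valid assembly) is a placement of the $n^2$ pieces bijectively on the cells of the $n\times n$ board, together with a choice of one of the four orientations for each piece, such that whenever two pieces are placed in adjacent cells, the colors of their sides along the common edge coincide (there is no restriction along the boundary of the board). Each solution induces an edge coloring of the $2n(n+1)$ edges of the board. Two solutions are distinguishable if the edge colorings they induce are not equal up to rotation of the entire board by a multiple of $90^\circ$; the number of distinguishable solutions is the number of equivalence classes, under rotation of the board by multiples of $90^\circ$, of edge colorings induced by solutions. *)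

theory Defs
  imports "HOL-Probability.Probability"
begin

text \<open>
  The board is the square \<open>[0,n] \<times> [0,n]\<close>. The cell \<open>(x, y)\<close> is the unit square with lower left
  corner \<open>(x, y)\<close>. \<open>Hor x y\<close> is the segment from \<open>(x, y)\<close> to \<open>(x + 1, y)\<close>, and
  \<open>Ver x y\<close> is the segment from \<open>(x, y)\<close> to \<open>(x, y + 1)\<close>.
\<close>

type_synonym cell = "nat \<times> nat"

datatype edge = Hor nat nat | Ver nat nat

definition cells :: "nat \<Rightarrow> cell set" where
  "cells n = {..<n} \<times> {..<n}"

definition edges :: "nat \<Rightarrow> edge set" where
  "edges n = {Hor x y | x y. x < n \<and> y \<le> n} \<union> {Ver x y | x y. x \<le> n \<and> y < n}"

text \<open>The sides of a cell are numbered counterclockwise: bottom, right, top, left.\<close>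

definition side :: "cell \<Rightarrow> nat \<Rightarrow> edge" where
  "side u k = (case u of (x, y) \<Rightarrow>
     if k = 0 then Hor x y
     else if k = 1 then Ver (x + 1) y
     else if k = 2 then Hor x (y + 1)
     else Ver x y)"

text \<open>Colors are the numbers below \<open>q\<close>; a coloring is \<open>undefined\<close> outside \<open>edges n\<close>.\<close>

type_synonym coloring = "edge \<Rightarrow> nat"

definition random_puzzle :: "nat \<Rightarrow> nat \<Rightarrow> coloring pmf" where
  "random_puzzle n q = Pi_pmf (edges n) undefined (\<lambda>_. pmf_of_set {..<q})"

text \<open>
  A piece is named by the cell it was cut from. An assembly is given by \<open>\<pi>\<close> and \<open>r\<close>: the cell \<open>u\<close>
  receives the piece \<open>\<pi> u\<close>, turned clockwise by \<open>r u\<close> quarter turns, so that side \<open>k + r u\<close>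
  (modulo 4) of the piece lies along side \<open>k\<close> of the cell.
\<close>

definition shown_color ::
    "coloring \<Rightarrow> (cell \<Rightarrow> cell) \<Rightarrow> (cell \<Rightarrow> nat) \<Rightarrow> cell \<Rightarrow> nat \<Rightarrow> nat" where
  "shown_color c \<pi> r u k = c (side (\<pi> u) ((k + r u) mod 4))"

definition is_solution :: "nat \<Rightarrow> coloring \<Rightarrow> (cell \<Rightarrow> cell) \<Rightarrow> (cell \<Rightarrow> nat) \<Rightarrow> bool" where
  "is_solution n c \<pi> r \<longleftrightarrow>
     bij_betw \<pi> (cells n) (cells n) \<and> (\<forall>u\<in>cells n. r u < 4) \<and>
     (\<forall>u\<in>cells n. \<forall>v\<in>cells n. \<forall>k<4. \<forall>l<4. u \<noteq> v \<and> side u k = side v l \<longrightarrow>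
        shown_color c \<pi> r u k = shown_color c \<pi> r v l)"

definition induces ::
    "nat \<Rightarrow> coloring \<Rightarrow> (cell \<Rightarrow> cell) \<Rightarrow> (cell \<Rightarrow> nat) \<Rightarrow> coloring \<Rightarrow> bool" where
  "induces n c \<pi> r d \<longleftrightarrow>
     d \<in> extensional (edges n) \<and> (\<forall>u\<in>cells n. \<forall>k<4. d (side u k) = shown_color c \<pi> r u k)"

definition induced_colorings :: "nat \<Rightarrow> coloring \<Rightarrow> coloring set" where
  "induced_colorings n c = {d. \<exists>\<pi> r. is_solution n c \<pi> r \<and> induces n c \<pi> r d}"

text \<open>The counterclockwise quarter turn of the board maps the point \<open>(x, y)\<close> to \<open>(n - y, x)\<close>.\<close>

fun rot_edge :: "nat \<Rightarrow> edge \<Rightarrow> edge" where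
  "rot_edge n (Hor x y) = Ver (n - y) x"
| "rot_edge n (Ver x y) = Hor (n - 1 - y) x"

definition rot_coloring :: "nat \<Rightarrow> coloring \<Rightarrow> coloring" where
  "rot_coloring n d = restrict (d \<circ> rot_edge n) (edges n)"

definition rot_equiv :: "nat \<Rightarrow> coloring set \<Rightarrow> (coloring \<times> coloring) set" where
  "rot_equiv n D = {(d, d'). d \<in> D \<and> d' \<in> D \<and> (\<exists>m. d' = (rot_coloring n ^^ m) d)}"

definition num_distinguishable :: "nat \<Rightarrow> coloring \<Rightarrow> nat" where
  "num_distinguishable n c = card (induced_colorings n c // rot_equiv n (induced_colorings n c))"

lemma card_edges: "card (edges n) = 2 * n * (n + 1)"
proof -
  have "edges n = (\<lambda>(x, y). Hor x y) ` ({..<n} \<times> {..n}) \<union> (\<lambda>(x, y). Ver x y) ` ({..n} \<times> {..<n})"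
    by (auto simp: edges_def)
  also have "card \<dots> = card ((\<lambda>(x, y). Hor x y) ` ({..<n} \<times> {..n})) +
      card ((\<lambda>(x, y). Ver x y) ` ({..n} \<times> {..<n}))"
    by (rule card_Un_disjoint) auto
  also have "\<dots> = card ({..<n} \<times> {..n}) + card ({..n} \<times> {..<n})"
    by (subst (1 2) card_image) (auto simp: inj_on_def)
  finally show ?thesis
    by (simp add: algebra_simps)
qed

lemma rot_edge_side:
  assumes "(x, y) \<in> cells n" "k < 4"
  shows "rot_edge n (side (x, y) k) = side (n - 1 - y, x) ((k + 1) mod 4)"
proof -
  have "k = 0 \<or> k = 1 \<or> k = 2 \<or> k = 3"
    using assms(2) by auto
  then show ?thesis
    using assms(1) by (auto simp: side_def cells_def)
qed

lemma rot_edge_in: "e \<in> edges n \<Longrightarrow> rot_edge n e \<in> edges n"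
  by (auto simp: edges_def)

lemma rot_edge_4: "e \<in> edges n \<Longrightarrow> rot_edge n (rot_edge n (rot_edge n (rot_edge n e))) = e"
  by (auto simp: edges_def)

lemma rot_coloring_4:
  assumes "d \<in> extensional (edges n)"
  shows "(rot_coloring n ^^ 4) d = d"
proof
  fix e
  have "(rot_coloring n ^^ 4) d =
      rot_coloring n (rot_coloring n (rot_coloring n (rot_coloring n d)))"
    by (simp add: eval_nat_numeral)
  then show "(rot_coloring n ^^ 4) d e = d e"
    using assms
    by (cases "e \<in> edges n")
      (simp_all add: rot_coloring_def rot_edge_in rot_edge_4 extensional_def)
qed

lemma equiv_rot_equiv:
  assumes "D \<subseteq> extensional (edges n)"
  shows "equiv D (rot_equiv n D)"
proof (rule equivI)
  show "rot_equiv n D \<subseteq> D \<times> D"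
    by (auto simp: rot_equiv_def)
  show "refl_on D (rot_equiv n D)"
    by (auto simp: rot_equiv_def refl_on_def intro: exI[of _ 0])
  show "sym (rot_equiv n D)"
  proof (rule symI)
    fix d d' assume "(d, d') \<in> rot_equiv n D"
    then obtain m where m: "d \<in> D" "d' \<in> D" "d' = (rot_coloring n ^^ m) d"
      by (auto simp: rot_equiv_def)
    have "((rot_coloring n ^^ 4) ^^ j) d = d" for j
      using rot_coloring_4[of d n] m(1) assms by (induction j) auto
    then have "(rot_coloring n ^^ (4 * m)) d = d"
      by (simp only: funpow_mult mult.commute)
    moreover have "(rot_coloring n ^^ (3 * m)) d' = (rot_coloring n ^^ (3 * m + m)) d"
      by (simp only: m(3) funpow_add comp_apply)
    ultimately have "(rot_coloring n ^^ (3 * m)) d' = d"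
      by simp
    with m(1,2) show "(d', d) \<in> rot_equiv n D"
      unfolding rot_equiv_def by (metis (mono_tags, lifting) case_prodI mem_Collect_eq)
  qed
  show "trans (rot_equiv n D)"
  proof (rule transI)
    fix a b c assume "(a, b) \<in> rot_equiv n D" "(b, c) \<in> rot_equiv n D"
    then show "(a, c) \<in> rot_equiv n D"
      by (auto simp: rot_equiv_def) (metis comp_apply funpow_add)
  qed
qed

lemma equiv_induced_colorings:
  "equiv (induced_colorings n c) (rot_equiv n (induced_colorings n c))"
  by (rule equiv_rot_equiv) (auto simp: induced_colorings_def induces_def)

end

theory Submission
  imports Defs "HOL-Combinatorics.Permutations"
begin

text \<open>
  Every coloring with the same multiset of pieces up to rotation as \<open>c\<close> is induced by a solution of
  \<open>c\<close>, so it suffices to bound from below the size of the class of \<open>c\<close> under this relation. There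
  are \<open>q ^ (2 n (n + 1))\<close> equally likely colorings, and a random one rarely lies in a class that is
  much smaller than the average. The number of classes is at most the number of multisets of \<open>n\<^sup>2\<close>
  elements from about \<open>q ^ 4 / 4\<close> piece types. If \<open>q ^ 4\<close> is much larger than \<open>n\<^sup>2\<close>, this is about
  \<open>(e q ^ 4 / (4 n\<^sup>2)) ^ n\<^sup>2\<close>, and \<open>e < 4\<close> leaves room for the bound \<open>(n\<^sup>2 / q\<^sup>2) ^ n\<^sup>2\<close> even for
  \<open>q = n\<close>; if \<open>q ^ 4\<close> is smaller, the number of classes is negligible against \<open>q ^ (2 n\<^sup>2)\<close>. The
  remaining factor \<open>q ^ (2 n)\<close> makes the exceptional probability tend to \<open>0\<close>.
\<close>

section \<open>Piece types\<close>

text \<open>The orbit under cyclic shifts stands for a piece whose orientation is forgotten, so no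
  canonical representative has to be chosen.\<close>

fun rotations :: "'a \<times> 'a \<times> 'a \<times> 'a \<Rightarrow> ('a \<times> 'a \<times> 'a \<times> 'a) set" where
  "rotations (a, b, c, d) = {(a, b, c, d), (b, c, d, a), (c, d, a, b), (d, a, b, c)}"

lemma rotations_eq:
  assumes "w \<in> rotations v"
  shows "rotations w = rotations v"
proof -
  obtain a b c d where v: "v = (a, b, c, d)" by (cases v)
  have "w = (a, b, c, d) \<or> w = (b, c, d, a) \<or> w = (c, d, a, b) \<or> w = (d, a, b, c)"
    using assms by (simp add: v)
  then show ?thesis by (elim disjE; simp only: v rotations.simps; blast)
qed

text \<open>Orbits of size 4 (\<open>F\<close>) are pairwise disjoint sets of words, so there are at
  most \<open>card A ^ 4 / 4\<close> of them. Every other orbit (\<open>P\<close>) comes from a word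
  \<open>(a, b, a, b)\<close>, and there are only \<open>card A ^ 2\<close> of these.\<close>

lemma card_rotations_image:
  fixes A :: "nat set"
  assumes "finite A"
  shows "4 * card (rotations ` (A \<times> A \<times> A \<times> A)) \<le> card A ^ 4 + 4 * card A ^ 2"
proof -
  define W where "W = A \<times> A \<times> A \<times> A"
  define F where "F = {R \<in> rotations ` W. card R = 4}"
  define P where "P = rotations ` ((\<lambda>(a, b). (a, b, a, b)) ` (A \<times> A))"
  have fin: "finite W" using assms by (simp add: W_def)
  have "rotations w \<in> F \<union> P" if "w \<in> W" for w
  proof -
    obtain a b c d where w: "w = (a, b, c, d)" by (cases w) auto
    have mem: "a \<in> A" "b \<in> A" using that by (auto simp: W_def w)
    show ?thesis
    proof (cases "a = c \<and> b = d")
      case True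
      then have "w \<in> (\<lambda>(a, b). (a, b, a, b)) ` (A \<times> A)" using mem by (auto simp: w)
      then show ?thesis by (auto simp: P_def)
    next
      case False
      \<comment> \<open>If two of the four shifts coincided, a nontrivial cyclic shift would fix the
        word, hence so would the shift by two, forcing \<open>a = c\<close> and
        \<open>b = d\<close>.\<close>
      then have "distinct [(a, b, c, d), (b, c, d, a), (c, d, a, b), (d, a, b, c)]" by auto
      from distinct_card[OF this] have "card (rotations w) = 4" by (simp add: w)
      then show ?thesis using that by (auto simp: F_def)
    qed
  qed
  then have sub: "rotations ` W \<subseteq> F \<union> P" by auto
  have finF: "finite F" and finP: "finite P" using fin assms by (auto simp: F_def P_def)
  have "R = rotations x" if "R \<in> F" "x \<in> R" for R x
    using that rotations_eq[of x] by (auto simp only: F_def)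
  then have "pairwise disjnt F"
    unfolding pairwise_def disjnt_def by blast
  then have "card (\<Union>F) = sum card F"
    by (rule card_Union_disjoint) (auto simp: F_def intro: card_ge_0_finite)
  also have "\<dots> = 4 * card F" by (simp add: F_def)
  finally have "4 * card F = card (\<Union>F)" ..
  also have "\<dots> \<le> card W"
    by (rule card_mono[OF fin]) (auto simp: F_def W_def)
  also have "card W = card A ^ 4"
    by (simp add: W_def card_cartesian_product power4_eq_xxxx)
  finally have F: "4 * card F \<le> card A ^ 4" .
  have "card P \<le> card (A \<times> A)"
    unfolding P_def using assms by (intro order.trans[OF card_image_le] card_image_le) auto
  then have P: "card P \<le> card A ^ 2" by (simp add: card_cartesian_product power2_eq_square)
  have "card (rotations ` W) \<le> card F + card P"
    using card_mono[OF _ sub] finF finP card_Un_le[of F P] by simp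
  then show ?thesis using F P unfolding W_def by linarith
qed

section \<open>Boxes of pieces and the assemblies they allow\<close>

definition piece :: "coloring \<Rightarrow> cell \<Rightarrow> nat \<times> nat \<times> nat \<times> nat" where
  "piece c u = (c (side u 0), c (side u 1), c (side u 2), c (side u 3))"

definition box :: "nat \<Rightarrow> coloring \<Rightarrow> (nat \<times> nat \<times> nat \<times> nat) set multiset" where
  "box n c = image_mset (\<lambda>u. rotations (piece c u)) (mset_set (cells n))"

text \<open>Equality of orbits makes \<open>piece d u\<close> one of the four shifts of
  \<open>piece c v\<close>; the length of the shift is the turn \<open>r\<close>, in the convention
  of \<open>shown_color\<close>.\<close>

lemma piece_rotation:
  assumes "rotations (piece d u) = rotations (piece c v)"
  shows "\<exists>r<4. \<forall>k<4. d (side u k) = c (side v ((k + r) mod 4))"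
proof -
  have *: "k < 4 \<longleftrightarrow> k = 0 \<or> k = 1 \<or> k = 2 \<or> k = (3::nat)" for k by auto
  have "piece d u \<in> rotations (piece c v)"
    unfolding assms[symmetric] by (cases "piece d u") auto
  then consider "piece d u = (c (side v 0), c (side v 1), c (side v 2), c (side v 3))"
    | "piece d u = (c (side v 1), c (side v 2), c (side v 3), c (side v 0))"
    | "piece d u = (c (side v 2), c (side v 3), c (side v 0), c (side v 1))"
    | "piece d u = (c (side v 3), c (side v 0), c (side v 1), c (side v 2))"
    unfolding piece_def[of c] rotations.simps by blast
  then show ?thesis
  proof cases
    case 1 then show ?thesis by (intro exI[of _ 0]) (auto simp: piece_def *)
  next
    case 2 then show ?thesis by (intro exI[of _ 1]) (auto simp: piece_def * simp flip: numeral_2_eq_2 numeral_3_eq_3)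
  next
    case 3 then show ?thesis
      by (intro exI[of _ 2]) (auto simp: piece_def * simp flip: numeral_2_eq_2 numeral_3_eq_3)
  next
    case 4 then show ?thesis by (intro exI[of _ 3]) (auto simp: piece_def *)
  qed
qed

lemma finite_cells: "finite (cells n)" and card_cells: "card (cells n) = n ^ 2"
  by (auto simp: cells_def card_cartesian_product power2_eq_square)

text \<open>Equal boxes give a permutation of the cells that matches pieces of the same type, and
  each match gives a turn. Adjacent cells then agree along a common edge because both show the color
  that \<open>d\<close> has there.\<close>

lemma induced_if_box_eq:
  assumes "d \<in> extensional (edges n)" "box n d = box n c"
  shows "d \<in> induced_colorings n c"
proof -
  obtain p where p: "p permutes cells n"
    and eq: "\<forall>u\<in>cells n. rotations (piece d u) = rotations (piece c (p u))"
    using image_mset_eq_implies_permutes[OF finite_cells assms(2)[unfolded box_def]] by blast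
  have "\<forall>u\<in>cells n. \<exists>r<4. \<forall>k<4. d (side u k) = c (side (p u) ((k + r) mod 4))"
    using eq piece_rotation by blast
  then obtain r where r: "\<forall>u\<in>cells n. r u < 4 \<and>
      (\<forall>k<4. d (side u k) = c (side (p u) ((k + r u) mod 4)))"
    by metis
  then have shown: "d (side u k) = shown_color c p r u k" if "u \<in> cells n" "k < 4" for u k
    using that by (auto simp: shown_color_def)
  have "is_solution n c p r"
    unfolding is_solution_def using r permutes_imp_bij[OF p] shown by metis
  moreover have "induces n c p r d"
    unfolding induces_def using assms(1) shown by auto
  ultimately show ?thesis unfolding induced_colorings_def by blast
qed

section \<open>Counting distinguishable solutions\<close>

lemma finite_edges: "finite (edges n)"
proof -
  have "edges n = (\<lambda>(x, y). Hor x y) ` ({..<n} \<times> {..n}) \<union> (\<lambda>(x, y). Ver x y) ` ({..n} \<times> {..<n})"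
    by (auto simp: edges_def)
  then show ?thesis by simp
qed

lemma side_in_edges: "u \<in> cells n \<Longrightarrow> side u k \<in> edges n"
  by (cases u) (auto simp: cells_def side_def edges_def)

lemma edge_is_side:
  assumes "e \<in> edges n"
  shows "\<exists>u\<in>cells n. \<exists>k<4. e = side u k"
proof (cases e)
  case (Hor x y)
  show ?thesis
  proof (cases "y < n")
    case True
    then show ?thesis using assms Hor
      by (intro bexI[of _ "(x, y)"] exI[of _ 0]) (auto simp: cells_def side_def edges_def)
  next
    \<comment> \<open>Here \<open>y = n\<close>: an edge of the top boundary, which belongs only to
      the cell below it. The right boundary is treated likewise.\<close>
    case False
    then show ?thesis using assms Hor
      by (intro bexI[of _ "(x, y - 1)"] exI[of _ 2]) (auto simp: cells_def side_def edges_def)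
  qed
next
  case (Ver x y)
  show ?thesis
  proof (cases "x < n")
    case True
    then show ?thesis using assms Ver
      by (intro bexI[of _ "(x, y)"] exI[of _ 3]) (auto simp: cells_def side_def edges_def)
  next
    case False
    then show ?thesis using assms Ver
      by (intro bexI[of _ "(x - 1, y)"] exI[of _ 1]) (auto simp: cells_def side_def edges_def)
  qed
qed

text \<open>A solution shows only colors that occur in \<open>c\<close>. This yields the finiteness
  on which the cardinality comparisons rest.\<close>

lemma induced_colorings_subset: "induced_colorings n c \<subseteq> edges n \<rightarrow>\<^sub>E c ` edges n"
proof
  fix d assume "d \<in> induced_colorings n c"
  then obtain p r where sol: "is_solution n c p r" and ind: "induces n c p r d"
    by (auto simp: induced_colorings_def)
  show "d \<in> edges n \<rightarrow>\<^sub>E c ` edges n"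
  proof (rule PiE_I)
    fix e assume "e \<in> edges n"
    then obtain u k where u: "u \<in> cells n" "k < 4" "e = side u k"
      using edge_is_side by blast
    then have "d e = c (side (p u) ((k + r u) mod 4))"
      using ind by (auto simp: induces_def shown_color_def)
    moreover have "p u \<in> cells n"
      using sol u(1) by (auto simp: is_solution_def bij_betw_def)
    ultimately show "d e \<in> c ` edges n" using side_in_edges by auto
  qed (use ind in \<open>auto simp: induces_def extensional_def\<close>)
qed

lemma finite_induced_colorings: "finite (induced_colorings n c)"
  by (rule finite_subset[OF induced_colorings_subset]) (intro finite_PiE finite_edges finite_imageI)

text \<open>Four quarter turns act as the identity on extensional colorings, so a rotation class has
  at most four elements.\<close>

lemma card_induced_le: "card (induced_colorings n c) \<le> 4 * num_distinguishable n c"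
proof -
  define D where "D = induced_colorings n c"
  define R where "R = rot_equiv n D"
  have fin: "finite D" unfolding D_def by (rule finite_induced_colorings)
  have eq: "equiv D R" unfolding D_def R_def by (rule equiv_induced_colorings)
  have ext: "D \<subseteq> extensional (edges n)" by (auto simp: D_def induced_colorings_def induces_def)
  have fq: "finite (D // R)"
    by (rule finite_subset[OF _ finite_Pow_iff[THEN iffD2, OF fin]])
      (auto simp: quotient_def R_def rot_equiv_def)
  have "card X \<le> 4" if X: "X \<in> D // R" for X
  proof -
    obtain d where d: "d \<in> D" "X = R `` {d}" using X by (auto elim: quotientE)
    have "X \<subseteq> (\<lambda>m. (rot_coloring n ^^ m) d) ` {..<4}"
    proof
      fix d' assume "d' \<in> X"
      then obtain m where m: "d' = (rot_coloring n ^^ m) d"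
        using d by (auto simp: R_def rot_equiv_def)
      have "(rot_coloring n ^^ 4) d = d" using d(1) ext rot_coloring_4 by blast
      then have "d' = (rot_coloring n ^^ (m mod 4)) d"
        unfolding m by (rule funpow_mod_eq[symmetric])
      then show "d' \<in> (\<lambda>m. (rot_coloring n ^^ m) d) ` {..<4}" by auto
    qed
    then have "card X \<le> card ((\<lambda>m. (rot_coloring n ^^ m) d) ` {..<4})" by (intro card_mono) auto
    also have "\<dots> \<le> card {..<4::nat}" by (rule card_image_le) simp
    also have "\<dots> = 4" by simp
    finally show ?thesis .
  qed
  then have "(\<Sum>X\<in>D // R. card X) \<le> 4 * card (D // R)"
    using sum_bounded_above[of "D // R" card 4] by (simp add: mult.commute)
  moreover have "card D \<le> (\<Sum>X\<in>D // R. card X)"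
    using card_UN_le[OF fq, of "\<lambda>X. X"] Union_quotient[OF eq] by simp
  ultimately show ?thesis
    unfolding num_distinguishable_def D_def R_def by linarith
qed

section \<open>Averaging over the boxes\<close>

text \<open>The set splits according to the value of \<open>f\<close> into at most
  \<open>card B\<close> parts, and each nonempty part lies in a fibre of at most \<open>s\<close>
  points.\<close>

lemma card_few_in_fibre:
  assumes "finite \<Omega>" "finite B" "f ` \<Omega> \<subseteq> B" "s \<ge> 0"
  shows "real (card {x \<in> \<Omega>. real (card {y \<in> \<Omega>. f y = f x}) \<le> s}) \<le> s * card B"
proof -
  define X where "X = {x \<in> \<Omega>. real (card {y \<in> \<Omega>. f y = f x}) \<le> s}"
  have "X \<subseteq> (\<Union>b\<in>B. {x \<in> X. f x = b})" using assms(3) by (auto simp: X_def)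
  then have "card X \<le> card (\<Union>b\<in>B. {x \<in> X. f x = b})"
    using assms by (intro card_mono) (auto simp: X_def)
  also have "\<dots> \<le> (\<Sum>b\<in>B. card {x \<in> X. f x = b})" by (rule card_UN_le[OF assms(2)])
  finally have "real (card X) \<le> (\<Sum>b\<in>B. real (card {x \<in> X. f x = b}))"
    by (metis of_nat_le_iff of_nat_sum)
  also have "\<dots> \<le> (\<Sum>b\<in>B. s)"
  proof (rule sum_mono)
    fix b
    show "real (card {x \<in> X. f x = b}) \<le> s"
    proof (cases "{x \<in> X. f x = b} = {}")
      case True then show ?thesis using assms(4) by (simp only: card.empty of_nat_0)
    next
      case False
      then obtain x where x: "x \<in> X" "f x = b" by auto
      have "card {x \<in> X. f x = b} \<le> card {y \<in> \<Omega>. f y = f x}"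
        using x assms(1) by (intro card_mono) (auto simp: X_def)
      then show ?thesis using x by (auto simp: X_def)
    qed
  qed
  finally show ?thesis by (simp add: X_def mult.commute)
qed

text \<open>A coloring with at most \<open>s\<close> distinguishable solutions lies in a fibre of
  \<open>box n\<close> of size at most \<open>4 * s\<close>. The number of fibres is bounded by the
  number of multisets of piece types.\<close>

lemma prob_few_solutions_le:
  assumes "q > 0" "s \<ge> 0"
  defines "T \<equiv> card (rotations ` ({..<q} \<times> {..<q} \<times> {..<q} \<times> {..<q}))"
  shows "measure_pmf.prob (random_puzzle n q) {c. real (num_distinguishable n c) \<le> s}
    \<le> 4 * s * ((T + n\<^sup>2) choose n\<^sup>2) / real q ^ (2 * n * (n + 1))"
proof -
  define A where "A = {..<q}"
  define \<Omega> where "\<Omega> = PiE_dflt (edges n) undefined (\<lambda>_. A)"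
  define types where "types = rotations ` (A \<times> A \<times> A \<times> A)"
  define B where "B = multisets_of_size types (n\<^sup>2)"
  have A: "finite A" "A \<noteq> {}" using assms(1) by (auto simp: A_def lessThan_empty_iff)
  have fin\<Omega>: "finite \<Omega>" using A finite_edges by (auto simp: \<Omega>_def)
  have ne: "\<Omega> \<noteq> {}" using A by (auto simp: \<Omega>_def PiE_dflt_empty_iff)
  have card\<Omega>: "real (card \<Omega>) = real q ^ (2 * n * (n + 1))"
    using A finite_edges by (simp add: \<Omega>_def card_PiE_dflt card_edges A_def)
  have ext: "c \<in> extensional (edges n)" if "c \<in> \<Omega>" for c
    using that by (auto simp: \<Omega>_def PiE_dflt_def extensional_def)
  have finB: "finite B" unfolding B_def types_def using A by auto
  \<comment> \<open>Stars and bars; the truncated \<open>- 1\<close> is given away in the next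
    step.\<close>
  have "card B = (T + n\<^sup>2 - 1) choose n\<^sup>2"
    unfolding B_def T_def using A by (subst card_multisets_of_size) (auto simp: types_def A_def)
  also have "\<dots> \<le> (T + n\<^sup>2) choose n\<^sup>2" by (rule binomial_right_mono) simp_all
  finally have cardB: "card B \<le> (T + n\<^sup>2) choose n\<^sup>2" .
  have "box n c \<in> B" if "c \<in> \<Omega>" for c
  proof -
    have "piece c u \<in> A \<times> A \<times> A \<times> A" if "u \<in> cells n" for u
      using \<open>c \<in> \<Omega>\<close> side_in_edges[OF that] by (auto simp: piece_def \<Omega>_def PiE_dflt_def)
    then show ?thesis
      using finite_cells by (auto simp: B_def multisets_of_size_def box_def types_def card_cells)
  qed
  then have img: "box n ` \<Omega> \<subseteq> B" by auto
  \<comment> \<open>The whole fibre of \<open>c\<close> is induced by solutions of \<open>c\<close>;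
    the factor 4 pays for the rotations of the board.\<close>
  have "real (card {d \<in> \<Omega>. box n d = box n c}) \<le> 4 * s"
    if "c \<in> \<Omega>" "real (num_distinguishable n c) \<le> s" for c
  proof -
    have "card {d \<in> \<Omega>. box n d = box n c} \<le> card (induced_colorings n c)"
      using finite_induced_colorings induced_if_box_eq ext by (intro card_mono) auto
    also have "\<dots> \<le> 4 * num_distinguishable n c" by (rule card_induced_le)
    finally show ?thesis using that(2) by linarith
  qed
  then have "card (\<Omega> \<inter> {c. real (num_distinguishable n c) \<le> s})
      \<le> card {c \<in> \<Omega>. real (card {d \<in> \<Omega>. box n d = box n c}) \<le> 4 * s}"
    using fin\<Omega> by (intro card_mono) auto
  then have "real (card (\<Omega> \<inter> {c. real (num_distinguishable n c) \<le> s}))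
      \<le> real (card {c \<in> \<Omega>. real (card {d \<in> \<Omega>. box n d = box n c}) \<le> 4 * s})"
    by simp
  also have "\<dots> \<le> 4 * s * card B"
    using card_few_in_fibre[OF fin\<Omega> finB img, of "4 * s"] assms(2) by simp
  also have "\<dots> \<le> 4 * s * ((T + n\<^sup>2) choose n\<^sup>2)"
    using cardB assms(2) by (intro mult_left_mono) auto
  finally have "real (card (\<Omega> \<inter> {c. real (num_distinguishable n c) \<le> s})) \<le> \<dots>" .
  moreover have "random_puzzle n q = pmf_of_set \<Omega>"
    unfolding random_puzzle_def \<Omega>_def A_def[symmetric]
    using A finite_edges by (intro Pi_pmf_of_set) auto
  ultimately show ?thesis
    by (simp add: measure_pmf_of_set[OF ne fin\<Omega>] card\<Omega> divide_right_mono)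
qed

section \<open>Estimates\<close>

text \<open>The binomial coefficient is isolated from a single term of the expansion of
  \<open>(N + b) ^ (T + N)\<close>. With \<open>t = b / N\<close> the bound per element is
  \<open>(1 + t)\<close> times the binary entropy of \<open>1 / (1 + t)\<close>.\<close>

lemma ln_binomial_le_entropy:
  fixes b :: real
  assumes "b > 0" "real T \<le> b" "N > 0"
  shows "ln (real ((T + N) choose N)) \<le> N * (ln (1 + b / N) + b / N * ln (1 + 1 / (b / N)))"
proof -
  have N: "real N > 0" using assms by simp
  have "real ((T + N) choose N) * real N ^ N * b ^ T \<le> (real N + b) ^ (T + N)"
  proof -
    have "real ((T + N) choose N) * real N ^ N * b ^ (T + N - N)
        \<le> (\<Sum>k\<le>T + N. real ((T + N) choose k) * real N ^ k * b ^ (T + N - k))"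
      using assms by (intro member_le_sum) auto
    then show ?thesis by (simp add: binomial_ring)
  qed
  then have "ln (real ((T + N) choose N) * real N ^ N * b ^ T) \<le> ln ((real N + b) ^ (T + N))"
    using assms by (intro ln_mono) auto
  then have "ln (real ((T + N) choose N)) \<le>
      (T + N) * ln (real N + b) - N * ln N - T * ln b"
    using assms by (simp add: ln_mult ln_realpow)
  also have "\<dots> = N * (ln (real N + b) - ln N) + T * (ln (real N + b) - ln b)"
    by (simp add: algebra_simps)
  \<comment> \<open>Replacing \<open>T\<close> by the larger \<open>b\<close> is allowed since its
    factor is nonnegative.\<close>
  also have "\<dots> \<le> N * (ln (real N + b) - ln N) + b * (ln (real N + b) - ln b)"
    using assms by (intro add_left_mono mult_right_mono) auto
  also have "ln (real N + b) - ln N = ln (1 + b / N)"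
    using assms N by (subst ln_divide_pos[symmetric]) (auto simp: add_divide_distrib)
  also have "ln (real N + b) - ln b = ln (1 + 1 / (b / N))"
    using assms N by (subst ln_divide_pos[symmetric]) (auto simp: add_divide_distrib add.commute)
  finally show ?thesis using N by (simp add: distrib_left)
qed

text \<open>For few types compared with cells. With \<open>y = sqrt t\<close> one has
  \<open>1 + 1 / y^2 \<le> (1 + 1 / y)^2\<close>, so the second summand is at most
  \<open>2 * y\<close>.\<close>

lemma entropy_le_sqrt:
  fixes t :: real
  assumes "0 < t" "t \<le> 1"
  shows "ln (1 + t) + t * ln (1 + 1 / t) \<le> 3 * sqrt t"
proof -
  define y where "y = sqrt t"
  have y: "0 < y" "y \<le> 1" "t = y\<^sup>2" using assms by (auto simp: y_def)
  have "ln (1 + t) \<le> t" using assms by (intro ln_add_one_self_le_self) auto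
  also have "t \<le> y" using y by (simp add: power2_eq_square mult_left_le_one_le)
  finally have 1: "ln (1 + t) \<le> y" .
  have "ln (1 + 1 / t) \<le> ln ((1 + 1 / y)\<^sup>2)"
    using y by (intro ln_mono) (auto simp: power2_eq_square field_simps add_pos_pos)
  also have "\<dots> = 2 * ln (1 + 1 / y)" using y by (simp add: ln_realpow add_pos_pos)
  also have "\<dots> \<le> 2 * (1 / y)" using y ln_add_one_self_le_self[of "1 / y"] by simp
  finally have "t * ln (1 + 1 / t) \<le> t * (2 * (1 / y))" using assms by (intro mult_left_mono) auto
  also have "\<dots> = 2 * y" using y by (simp add: power2_eq_square)
  finally show ?thesis using 1 by (simp add: y_def)
qed

text \<open>For many types; the summand 1 is the logarithm of the factor \<open>e\<close> in the
  estimate of the binomial coefficient.\<close>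

lemma entropy_le_ln:
  fixes t :: real
  assumes "0 < t"
  shows "ln (1 + t) + t * ln (1 + 1 / t) \<le> 1 + ln (1 + t)"
proof -
  have "t * ln (1 + 1 / t) \<le> t * (1 / t)"
    using assms by (intro mult_left_mono ln_add_one_self_le_self) auto
  then show ?thesis using assms by simp
qed

text \<open>Per cell, the logarithms of the number of boxes and of the target number of solutions
  together stay below that of \<open>q^2\<close>. The slack \<open>10 / ln n * ln m\<close> absorbs
  the errors.\<close>

lemma exponent_estimate:
  fixes q n :: nat
  assumes q: "2 \<le> q" "q \<le> n" and n: "n \<ge> 25"
  defines "t \<equiv> (real q ^ 4 / 4 + real q ^ 2) / real n ^ 2"
    and "m \<equiv> min (real q ^ 2) (real n ^ 2 / real q ^ 2)"
  shows "ln (1 + t) + t * ln (1 + 1 / t) + (1 - 10 / ln n) * ln m \<le> 2 * ln q"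
proof -
  have n0: "real n \<ge> 25" "real n > 0" and q0: "real q \<ge> 2" "real q > 0" and qn: "real q \<le> n"
    using q n by auto
  have L: "ln (real n) > 0" using n0 by simp
  have t0: "t > 0" using n0 q0 unfolding t_def by (intro divide_pos_pos add_pos_pos) auto
  have q2: "real q ^ 2 \<ge> 4" using power_mono[OF q0(1), of 2] by simp
  have q4: "real q ^ 4 = (real q ^ 2) ^ 2" by simp
  have "real q ^ 2 * 4 \<le> real q ^ 2 * real q ^ 2" using q2 by (intro mult_left_mono) auto
  then have t_half: "t \<le> real q ^ 4 / 2 / real n ^ 2"
    unfolding t_def q4 using n0 by (intro divide_right_mono) (auto simp: power2_eq_square)
  show ?thesis
  proof (cases "real q ^ 2 \<le> n")
    case True
    have "real q ^ 2 * real q ^ 2 \<le> n * real n" using True by (intro mult_mono) auto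
    then have m: "m = real q ^ 2" and qq: "real q ^ 4 \<le> real n ^ 2"
      using q0 by (auto simp: m_def min_def field_simps q4 power2_eq_square)
    have "t \<le> (real q ^ 2 / n) ^ 2"
      by (intro order.trans[OF t_half]) (use n0 in \<open>auto simp: power_divide intro!: divide_left_mono\<close>)
    have "real q ^ 4 \<le> 2 * real n ^ 2" using qq zero_le_power2[of "real n"] by linarith
    then have "real q ^ 4 / 2 / real n ^ 2 \<le> 1" using n0 by simp
    then have "t \<le> 1" using t_half by linarith
    with \<open>t \<le> (real q ^ 2 / n) ^ 2\<close> have "sqrt t \<le> real q ^ 2 / n"
      using n0 by (intro real_le_lsqrt) (auto simp: t0 less_imp_le)
    then have f: "ln (1 + t) + t * ln (1 + 1 / t) \<le> 3 * (real q ^ 2 / n)"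
      using entropy_le_sqrt[OF t0 \<open>t \<le> 1\<close>] by linarith
    \<comment> \<open>\<open>ln x / x\<close> decreases from \<open>e\<close> on, and
      \<open>e < 4 \<le> q^2 \<le> n\<close>. Hence the slack dominates the entropy term.\<close>
    have "ln (real n) / n \<le> ln (real q ^ 2) / real q ^ 2"
      using True q2 exp_le by (intro ln_x_over_x_mono) auto
    then have "real q ^ 2 / n \<le> ln (real q ^ 2) / ln (real n)"
      using n0 q0 L by (simp add: field_simps)
    moreover have "ln (real q ^ 2) / ln (real n) \<ge> 0" using q2 L by simp
    ultimately have "3 * (real q ^ 2 / n) \<le> 10 / ln n * ln m" unfolding m by simp
    moreover have "ln m = 2 * ln q" unfolding m using q0 by (simp add: ln_realpow)
    ultimately show ?thesis using f by (simp add: algebra_simps)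
  next
    case False
    define s where "s = real q ^ 4 / real n ^ 2"
    have "n * real n \<le> real q ^ 2 * real q ^ 2" using False by (intro mult_mono) auto
    then have m: "m = real n ^ 2 / real q ^ 2"
      using q0 by (auto simp: m_def min_def field_simps power2_eq_square)
    have qn2: "real q ^ 2 \<le> real n ^ 2" using qn by (intro power_mono) auto
    have m1: "m \<ge> 1" unfolding m using q0 qn2 by simp
    have "s > 0" using q0 n0 by (simp add: s_def)
    \<comment> \<open>It remains to compare \<open>1 + ln (1 + t)\<close> with \<open>ln s\<close>
      plus the slack.\<close>
    have lns: "ln s = 2 * ln q - ln m"
      unfolding s_def m using q0 n0 by (simp add: ln_div ln_realpow)
    have f: "ln (1 + t) + t * ln (1 + 1 / t) \<le> 1 + ln (1 + t)" by (rule entropy_le_ln[OF t0])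
    show ?thesis
    proof (cases "s \<le> 25")
      case True
      have "n * real n \<le> real q ^ 2 * real q ^ 2" by fact
      then have "s \<ge> 1" using n0 by (simp add: s_def q4 power2_eq_square)
      then have lns0: "ln s \<ge> 0" by simp
      have "t \<le> 12.5" using t_half True by (simp add: s_def)
      \<comment> \<open>Since \<open>1 + t \<le> 13.5 < 2 ^ 4\<close>, the left side is at most 5 in
        total.\<close>
      have "1 + t \<le> exp 1 ^ 4"
        using \<open>t \<le> 12.5\<close> power_mono[of 2 "exp (1::real)" 4] exp_ge_add_one_self[of 1] by simp
      then have "ln (1 + t) \<le> ln (exp 1 ^ 4)" using t0 by (intro ln_mono) auto
      then have f5: "ln (1 + t) \<le> 4" by (simp add: ln_realpow)
      \<comment> \<open>From \<open>s \<le> 25 \<le> n\<close> follows \<open>n \<le> m^2\<close>,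
        so \<open>ln m\<close> is at least half of \<open>ln n\<close> and the slack is at least
        5.\<close>
      have "n * (25 * real n ^ 2) \<le> n * (n * real n ^ 2)" using n0 by (intro mult_left_mono mult_right_mono) auto
      moreover have "real q ^ 4 \<le> 25 * real n ^ 2" using True n0 by (simp add: s_def field_simps)
      then have "n * real q ^ 4 \<le> n * (25 * real n ^ 2)" by (intro mult_left_mono) auto
      ultimately have "real n \<le> m ^ 2"
        unfolding m using q0 by (simp add: field_simps power2_eq_square power4_eq_xxxx)
      then have "ln (real n) \<le> ln (m ^ 2)" using n0 by (intro ln_mono) auto
      then have "ln (real n) \<le> 2 * ln m" using m1 by (simp add: ln_realpow)
      then have "5 \<le> 10 / ln n * ln m" using L by (simp add: field_simps)
      then show ?thesis using f f5 lns lns0 by (simp add: algebra_simps)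
    next
      case False
      have "t = s / 4 + real q ^ 2 / real n ^ 2" by (simp add: t_def s_def add_divide_distrib)
      moreover have "real q ^ 2 / real n ^ 2 \<le> 1" using qn2 n0 by simp
      ultimately have t: "1 + t \<le> 2 + s / 4" by linarith
      \<comment> \<open>Here \<open>6 + 3 * s / 4 \<le> s\<close> as \<open>s > 25\<close>. The
        leading coefficient stays below 1 because \<open>e \<le> 3 < 4\<close>, where 4 is the
        number of orientations.\<close>
      have "exp 1 * (1 + t) \<le> 3 * (2 + s / 4)"
        using t exp_le t0 by (intro mult_mono) auto
      also have "\<dots> \<le> s" using False by simp
      finally have "ln (exp 1 * (1 + t)) \<le> ln s" using t0 by (intro ln_mono) auto
      then have "1 + ln (1 + t) \<le> ln s" using t0 by (simp add: ln_mult)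
      moreover have "10 / ln n * ln m \<ge> 0" using m1 L by simp
      ultimately show ?thesis using f lns by (simp add: algebra_simps)
    qed
  qed
qed

section \<open>Exponentially small failure probability and the limit\<close>

lemma prob_few_solutions_exp_small:
  fixes q n :: nat
  assumes q: "2 \<le> q" "q \<le> n" and n: "n \<ge> 25"
  defines "m \<equiv> min (real q ^ 2) (real n ^ 2 / real q ^ 2)"
  shows "measure_pmf.prob (random_puzzle n q)
      {c. real (num_distinguishable n c) \<le> m powr ((1 - 10 / ln n) * real n ^ 2)} \<le> 4 * (1 / 4) ^ n"
proof -
  define T where "T = card (rotations ` ({..<q} \<times> {..<q} \<times> {..<q} \<times> {..<q}))"
  define t where "t = (real q ^ 4 / 4 + real q ^ 2) / real n ^ 2"
  define M where "M = real ((T + n\<^sup>2) choose n\<^sup>2)"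
  define s where "s = m powr ((1 - 10 / ln n) * real n ^ 2)"
  have q0: "real q > 0" "real q \<ge> 2" and n0: "real n > 0" using q n by auto
  have m: "m > 0" using q0 n0 by (simp add: m_def)
  have M: "M > 0" by (simp add: M_def)
  have s: "s > 0" using m by (simp add: s_def)
  have "4 * T \<le> q ^ 4 + 4 * q ^ 2"
    using card_rotations_image[of "{..<q}"] by (simp add: T_def)
  then have "real (4 * T) \<le> real (q ^ 4 + 4 * q ^ 2)" by (rule of_nat_mono)
  then have "real T \<le> real q ^ 4 / 4 + real q ^ 2" by simp
  then have "ln M \<le> real (n\<^sup>2) * (ln (1 + t) + t * ln (1 + 1 / t))"
    unfolding M_def t_def using ln_binomial_le_entropy[of "real q ^ 4 / 4 + real q ^ 2" T "n\<^sup>2"] q0 n0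
    by (simp add: add_pos_pos)
  moreover have "ln s = real (n\<^sup>2) * ((1 - 10 / ln n) * ln m)"
    using m by (simp add: s_def ln_powr)
  ultimately have "ln s + ln M \<le>
      real (n\<^sup>2) * (ln (1 + t) + t * ln (1 + 1 / t) + (1 - 10 / ln n) * ln m)"
    by (simp add: algebra_simps)
  also have "\<dots> \<le> real (n\<^sup>2) * (2 * ln q)"
    using exponent_estimate[OF q n] unfolding t_def m_def by (intro mult_left_mono) auto
  also have "\<dots> = ln (real q ^ (2 * n\<^sup>2))" using q0 by (simp add: ln_realpow)
  finally have "ln (s * M) \<le> ln (real q ^ (2 * n\<^sup>2))" using s M by (simp add: ln_mult)
  then have sM: "s * M \<le> real q ^ (2 * n\<^sup>2)" using s M q0 by simp
  have "measure_pmf.prob (random_puzzle n q) {c. real (num_distinguishable n c) \<le> s}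
      \<le> 4 * s * M / real q ^ (2 * n * (n + 1))"
    unfolding M_def T_def using prob_few_solutions_le[of q s n] s q by simp
  \<comment> \<open>The exponent \<open>2 * n * (n + 1)\<close> splits as
    \<open>2 * n^2 + 2 * n\<close>: the first part cancels \<open>s * M\<close>, the second leaves
    the decay.\<close>
  also have "\<dots> = 4 * (s * M / real q ^ (2 * n\<^sup>2)) * (1 / (real q ^ 2) ^ n)"
    using q0 by (simp add: power_add power2_eq_square algebra_simps mult_2_right flip: power_mult)
  also have "\<dots> \<le> 4 * 1 * (1 / 4 ^ n)"
  proof (intro mult_mono)
    show "s * M / real q ^ (2 * n\<^sup>2) \<le> 1" using sM q0 by simp
    have "4 \<le> real q ^ 2" using power_mono[OF q0(2), of 2] by simp
    then show "1 / (real q ^ 2) ^ n \<le> 1 / 4 ^ n" using q0 by (intro divide_left_mono power_mono) auto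
  qed (use s M q0 in auto)
  finally show ?thesis by (simp add: s_def power_divide)
qed

theorem mainTheorem4:
  fixes q :: "nat \<Rightarrow> nat"
  assumes "\<And>n. n \<ge> 2 \<Longrightarrow> 2 \<le> q n \<and> q n \<le> n"
  shows "\<exists>\<epsilon> :: nat \<Rightarrow> real. \<epsilon> \<longlonglongrightarrow> 0 \<and>
    (\<lambda>n. measure_pmf.prob (random_puzzle n (q n))
       {c. real (num_distinguishable n c) >
           min (real (q n) ^ 2) (real n ^ 2 / real (q n) ^ 2) powr ((1 - \<epsilon> n) * real n ^ 2)})
    \<longlonglongrightarrow> 1"
proof (intro exI conjI)
  let ?P = "\<lambda>n. measure_pmf.prob (random_puzzle n (q n))
       {c. real (num_distinguishable n c) >
           min (real (q n) ^ 2) (real n ^ 2 / real (q n) ^ 2) powr ((1 - 10 / ln n) * real n ^ 2)}"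
  \<comment> \<open>The witness is \<open>\<epsilon> n = 10 / ln n\<close>, the slack of the
    exponent estimate.\<close>
  have "filterlim (\<lambda>n. ln (real n)) at_top sequentially"
    by (rule filterlim_compose[OF ln_at_top filterlim_real_sequentially])
  then show "(\<lambda>n. 10 / ln (real n)) \<longlonglongrightarrow> 0"
    by (rule real_tendsto_divide_at_top[OF tendsto_const])
  have lower: "1 - 4 * (1 / 4) ^ n \<le> ?P n" if "n \<ge> 25" for n
  proof -
    let ?b = "min (real (q n) ^ 2) (real n ^ 2 / real (q n) ^ 2) powr ((1 - 10 / ln n) * real n ^ 2)"
    have "{c. real (num_distinguishable n c) > ?b} = UNIV - {c. real (num_distinguishable n c) \<le> ?b}"
      by auto
    then have "?P n = 1 - measure_pmf.prob (random_puzzle n (q n))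
        {c. real (num_distinguishable n c) \<le> ?b}"
      using measure_pmf.prob_compl[of "{c. real (num_distinguishable n c) \<le> ?b}"] by simp
    moreover have "2 \<le> q n" "q n \<le> n" using assms[of n] that by auto
    ultimately show ?thesis using prob_few_solutions_exp_small[of "q n" n] that by simp
  qed
  show "?P \<longlonglongrightarrow> 1"
  proof (rule tendsto_sandwich[of "\<lambda>n. 1 - 4 * (1 / 4) ^ n" _ _ "\<lambda>_. 1"])
    show "\<forall>\<^sub>F n in sequentially. 1 - 4 * (1 / 4) ^ n \<le> ?P n"
      using lower by (auto simp: eventually_sequentially)
    have "(\<lambda>n. 1 - 4 * (1 / 4 :: real) ^ n) \<longlonglongrightarrow> 1 - 4 * 0"
      by (intro tendsto_intros LIMSEQ_power_zero) auto
    then show "(\<lambda>n. 1 - 4 * (1 / 4 :: real) ^ n) \<longlonglongrightarrow> 1" by simp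
  qed auto
qed

end
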